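(* Let $G$ be a finite simple graph without isolated vertices. If $G$ admits a FAT $k$-coloring with parameter $\alpha$, then $\lambda=k\alpha$ is an eigenvalue of the normalized Laplacian $L(G)$ with multiplicity at least $\max\{1,k-1\}$.
   Context: For $v\in V$ and $S\subseteq V$, let $e(v,S)$ denote the number of neighbors of $v$ in $S$. A vertex $k$-coloring of $G$ is a function $c:V\to\{1,\ldots,k\}$ with coloring classes $V_i=c^{-1}(i)$. It is Fair and Tolerant (FAT) with parameter $\alpha\in[0,1]$ if, with $\beta:=1-(k-1)\alpha$, for every vertex $v$ and every $i$ we have $e(v,V_i)=\alpha\deg v$ if $v\notin V_i$ and $e(v,V_i)=\beta\deg v$ if $v\in V_i$. With $A$ the adjacency matrix and $D=\mathrm{diag}(\deg v_1,\dots,\deg v_N)$ the degree matrix, the normalized Laplacian is $L(G)=I-D^{-1}A$, i.e. $Lf(v)=f(v)-\frac{1}{\deg v}\sum_{w\sim v}f(w)$.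
   Formalization: Two degenerate cases where the claim can fail are excluded: for k = 1 the parameter is taken to be α = 0 (K_2 with α = 0.37 is a counterexample), and for α = 0 all k colors must be used (K_2, constant coloring, k = 5 is a counterexample). *)

theory Defs
  imports "HOL-Analysis.Analysis"
begin

(* A finite simple graph is an adjacency relation on a finite vertex type; the vertex set is
   UNIV, hence finite and nonempty. *)

definition simple_graph :: "('v::finite \<Rightarrow> 'v \<Rightarrow> bool) \<Rightarrow> bool" where
  "simple_graph adj \<longleftrightarrow> symp adj \<and> irreflp adj"

definition nbrs_in :: "('v::finite \<Rightarrow> 'v \<Rightarrow> bool) \<Rightarrow> 'v \<Rightarrow> 'v set \<Rightarrow> nat" where
  "nbrs_in adj v S = card {w \<in> S. adj v w}"

definition deg :: "('v::finite \<Rightarrow> 'v \<Rightarrow> bool) \<Rightarrow> 'v \<Rightarrow> nat" where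
  "deg adj v = card {w. adj v w}"

definition no_isolated_vertices :: "('v::finite \<Rightarrow> 'v \<Rightarrow> bool) \<Rightarrow> bool" where
  "no_isolated_vertices adj \<longleftrightarrow> (\<forall>v. deg adj v \<noteq> 0)"

definition color_class :: "('v::finite \<Rightarrow> nat) \<Rightarrow> nat \<Rightarrow> 'v set" where
  "color_class c i = {v. c v = i}"

(* Two degenerate cases: for k = 1 the condition does not constrain \<alpha> (the meaningful parameter is
   \<alpha> = 0), and for \<alpha> = 0 it does not force every color to be used, whereas for \<alpha> > 0 and a graph
   without isolated vertices it does. *)
definition FAT_coloring :: "('v::finite \<Rightarrow> 'v \<Rightarrow> bool) \<Rightarrow> nat \<Rightarrow> real \<Rightarrow> ('v \<Rightarrow> nat) \<Rightarrow> bool" where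
  "FAT_coloring adj k \<alpha> c \<longleftrightarrow>
     range c \<subseteq> {1..k} \<and> 0 \<le> \<alpha> \<and> \<alpha> \<le> 1 \<and>
     (let \<beta> = 1 - (real k - 1) * \<alpha> in
      \<forall>v. \<forall>i\<in>{1..k}.
        (v \<notin> color_class c i \<longrightarrow> real (nbrs_in adj v (color_class c i)) = \<alpha> * real (deg adj v)) \<and>
        (v \<in> color_class c i \<longrightarrow> real (nbrs_in adj v (color_class c i)) = \<beta> * real (deg adj v)))"

definition adjacency_matrix :: "('v::finite \<Rightarrow> 'v \<Rightarrow> bool) \<Rightarrow> real ^ 'v ^ 'v" where
  "adjacency_matrix adj = (\<chi> v w. if adj v w then 1 else 0)"

definition degree_matrix :: "('v::finite \<Rightarrow> 'v \<Rightarrow> bool) \<Rightarrow> real ^ 'v ^ 'v" where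
  "degree_matrix adj = (\<chi> v w. if v = w then real (deg adj v) else 0)"

definition normalized_laplacian :: "('v::finite \<Rightarrow> 'v \<Rightarrow> bool) \<Rightarrow> real ^ 'v ^ 'v" where
  "normalized_laplacian adj = mat 1 - matrix_inv (degree_matrix adj) ** adjacency_matrix adj"

definition is_eigenvalue :: "real ^ 'n ^ 'n \<Rightarrow> real \<Rightarrow> bool" where
  "is_eigenvalue M \<mu> \<longleftrightarrow> (\<exists>x. x \<noteq> 0 \<and> M *v x = \<mu> *s x)"

(* Geometric multiplicity. The normalized Laplacian is similar to a symmetric matrix, so for it
   this is also the algebraic multiplicity. *)
definition eigen_multiplicity :: "real ^ 'n ^ 'n \<Rightarrow> real \<Rightarrow> nat" where
  "eigen_multiplicity M \<mu> = dim {x. M *v x = \<mu> *s x}"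

lemma matrix_inv_degree_matrix:
  assumes "no_isolated_vertices adj"
  shows "matrix_inv (degree_matrix adj) = (\<chi> v w. if v = w then 1 / real (deg adj v) else 0)"
    (is "_ = ?E")
proof -
  have d: "deg adj v \<noteq> 0" for v
    using assms by (simp add: no_isolated_vertices_def)
  have 1: "degree_matrix adj ** ?E = mat 1" and 2: "?E ** degree_matrix adj = mat 1"
    by (simp_all add: degree_matrix_def matrix_matrix_mult_def mat_def vec_eq_iff d
        if_distrib[where f = "\<lambda>x. x * _"] cong: if_cong)
  have "matrix_inv (degree_matrix adj) ** degree_matrix adj = mat 1"
    unfolding matrix_inv_def
    by (rule someI2[where a = ?E]) (use 1 2 in \<open>blast+\<close>)
  then have "?E = matrix_inv (degree_matrix adj) ** degree_matrix adj ** ?E"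
    by (simp only: matrix_mul_lid)
  also have "\<dots> = matrix_inv (degree_matrix adj)"
    by (simp only: 1 matrix_mul_rid flip: matrix_mul_assoc)
  finally show ?thesis
    by (rule sym)
qed

lemma normalized_laplacian_apply:
  assumes "no_isolated_vertices adj"
  shows "(normalized_laplacian adj *v f) $ v
           = f $ v - (1 / real (deg adj v)) * (\<Sum>w | adj v w. f $ w)"
proof -
  have "(matrix_inv (degree_matrix adj) *v g) $ v = g $ v / real (deg adj v)" for g :: "real ^ 'a"
    by (simp add: matrix_inv_degree_matrix[OF assms] matrix_vector_mult_def
        if_distrib[where f = "\<lambda>x. x * _"] cong: if_cong)
  moreover have "(adjacency_matrix adj *v f) $ v = (\<Sum>w | adj v w. f $ w)"
    by (simp add: adjacency_matrix_def matrix_vector_mult_def sum.If_cases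
        if_distrib[where f = "\<lambda>x. x * _"] cong: if_cong)
  ultimately show ?thesis
    by (simp add: normalized_laplacian_def matrix_vector_mult_diff_rdistrib
        flip: matrix_vector_mul_assoc)
qed

end

theory Submission
  imports Defs
begin

text \<open>If \<open>f = a \<circ> c\<close> is constant on the color classes, then \<open>L f (v) = k \<alpha> f(v) - \<alpha> S\<close>, where \<open>S\<close> is the
  sum of the values of \<open>a\<close> over all colors, so \<open>f\<close> is an eigenvector for \<open>k \<alpha>\<close> as soon as \<open>\<alpha> S = 0\<close>.
  The differences \<open>1\<^bsub>V\<^sub>i\<^esub> - 1\<^bsub>V\<^sub>k\<^esub>\<close> with \<open>i < k\<close> satisfy \<open>S = 0\<close> and are independent because no class
  is empty. For \<open>k = 1\<close>, where \<open>\<alpha> = 0\<close>, a constant function works.\<close>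

text \<open>Grouping the neighbors of \<open>v\<close> by color turns the sum into one over colors,
  weighted by the prescribed neighbor counts.\<close>

lemma FAT_coloring_sum_neighbors:
  fixes a :: "nat \<Rightarrow> real"
  assumes "FAT_coloring adj k \<alpha> c"
  shows "(\<Sum>w | adj v w. a (c w)) =
           real (deg adj v) * (\<alpha> * (\<Sum>i = 1..k. a i) + (1 - real k * \<alpha>) * a (c v))"
proof -
  have ran: "c w \<in> {1..k}" for w
    using assms unfolding FAT_coloring_def by blast
  \<comment> \<open>Both cases of the coloring condition in one formula: the color of
    \<open>v\<close> itself has the surplus \<beta> - \<alpha> = 1 - k\<alpha>.\<close>
  have nb: "real (nbrs_in adj v (color_class c i)) =
      real (deg adj v) * (\<alpha> + (if i = c v then 1 - real k * \<alpha> else 0))"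
    if "i \<in> {1..k}" for i
    using assms that unfolding FAT_coloring_def Let_def color_class_def
    by (auto simp: algebra_simps)
  have "(\<Sum>w | adj v w. a (c w)) = (\<Sum>i = 1..k. \<Sum>w | adj v w \<and> c w = i. a (c w))"
    using sum.group[of "{w. adj v w}" "{1..k}" c "\<lambda>w. a (c w)"] image_subsetI[of _ c, OF ran]
    by simp
  also have "\<dots> = (\<Sum>i = 1..k. real (nbrs_in adj v (color_class c i)) * a i)"
    by (intro sum.cong refl) (simp add: nbrs_in_def color_class_def conj_commute)
  also have "\<dots> = (\<Sum>i = 1..k. real (deg adj v) *
      (\<alpha> * a i + (if i = c v then (1 - real k * \<alpha>) * a i else 0)))"
    by (intro sum.cong refl) (simp add: nb algebra_simps)
  also have "\<dots> = real (deg adj v) * (\<alpha> * (\<Sum>i = 1..k. a i) + (1 - real k * \<alpha>) * a (c v))"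
    using ran[of v] by (simp add: sum.distrib flip: sum_distrib_left)
  finally show ?thesis .
qed

lemma FAT_coloring_eigenvector:
  fixes a :: "nat \<Rightarrow> real"
  assumes "no_isolated_vertices adj" "FAT_coloring adj k \<alpha> c" "\<alpha> * (\<Sum>i = 1..k. a i) = 0"
  shows "normalized_laplacian adj *v (\<chi> v. a (c v)) = (real k * \<alpha>) *s (\<chi> v. a (c v))"
proof -
  have d: "deg adj v \<noteq> 0" for v
    using assms(1) by (simp add: no_isolated_vertices_def)
  show ?thesis
    using assms(3)
    by (auto simp: d vec_eq_iff normalized_laplacian_apply[OF assms(1)]
        FAT_coloring_sum_neighbors[OF assms(2)] algebra_simps)
qed

text \<open>No vertex has a neighbor in an empty class, yet each would need \<alpha> times its
  positive degree of them.\<close>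

lemma FAT_coloring_color_class_nonempty:
  assumes "no_isolated_vertices adj" "FAT_coloring adj k \<alpha> c" "\<alpha> \<noteq> 0" "i \<in> {1..k}"
  shows "color_class c i \<noteq> {}"
proof
  assume empty: "color_class c i = {}"
  then have "real (nbrs_in adj v (color_class c i)) = \<alpha> * real (deg adj v)" for v
    using assms(2,4) unfolding FAT_coloring_def Let_def by blast
  then show False
    using assms(1,3) by (simp add: empty nbrs_in_def no_isolated_vertices_def)
qed

text \<open>Reading off coordinate \<open>p i\<close> kills every member of the family except
  \<open>f i\<close>, so no member lies in the span of the others.\<close>

lemma card_le_dim_if_dual_coordinates:
  fixes f :: "'i \<Rightarrow> real ^ 'n" and p :: "'i \<Rightarrow> 'n"
  assumes "f ` I \<subseteq> W"
    and dual: "\<And>i j. i \<in> I \<Longrightarrow> j \<in> I \<Longrightarrow> f i $ p j = (if i = j then 1 else 0)"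
  shows "card I \<le> dim W"
proof -
  have inj: "inj_on f I"
    by (intro inj_onI) (metis dual zero_neq_one)
  have "independent (f ` I)"
    unfolding dependent_def
  proof clarify
    fix i assume i: "i \<in> I" and sp: "f i \<in> span (f ` I - {f i})"
    have "span (f ` I - {f i}) \<subseteq> {y. y $ p i = 0}"
      using dual i by (intro span_minimal) (auto simp: subspace_def)
    then show False
      using sp dual[OF i i] by auto
  qed
  with assms(1) have "card (f ` I) \<le> dim W"
    by (rule independent_card_le_dim)
  then show ?thesis
    by (simp add: card_image[OF inj])
qed

text \<open>An eigenspace has dimension 0 exactly when it contains only 0. This reduces the
  eigenvalue claim to a bound on the multiplicity.\<close>

lemma is_eigenvalue_iff_multiplicity:
  "is_eigenvalue M \<mu> \<longleftrightarrow> 1 \<le> eigen_multiplicity M \<mu>"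
proof -
  have "eigen_multiplicity M \<mu> = 0 \<longleftrightarrow> {x. M *v x = \<mu> *s x} \<subseteq> {0}"
    by (simp add: eigen_multiplicity_def dim_eq_0)
  then show ?thesis
    unfolding is_eigenvalue_def by (auto simp: Suc_le_eq)
qed

theorem theorem3p3:
  fixes adj :: "'v::finite \<Rightarrow> 'v \<Rightarrow> bool"
    and k :: nat and \<alpha> :: real and c :: "'v \<Rightarrow> nat"
  assumes "simple_graph adj"
    and "no_isolated_vertices adj"
    and "FAT_coloring adj k \<alpha> c"
    and "k = 1 \<Longrightarrow> \<alpha> = 0"
    and "\<alpha> = 0 \<Longrightarrow> \<forall>i\<in>{1..k}. color_class c i \<noteq> {}"
  shows "is_eigenvalue (normalized_laplacian adj) (real k * \<alpha>) \<and>
         eigen_multiplicity (normalized_laplacian adj) (real k * \<alpha>) \<ge> max 1 (k - 1)"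
proof -
  have "c v \<in> {1..k}" for v
    using assms(3) unfolding FAT_coloring_def by blast
  \<comment> \<open>The vertex type is inhabited, so at least one color occurs.\<close>
  then have "k \<ge> 1"
    by (meson atLeastAtMost_iff order_trans)
  have mult: "k - 1 \<le> eigen_multiplicity (normalized_laplacian adj) (real k * \<alpha>)"
  proof -
    \<comment> \<open>For \<alpha> = 0 this is an assumption of the theorem; otherwise the degrees
      force it.\<close>
    have "\<exists>v. c v = i" if "i \<in> {1..k}" for i
      using FAT_coloring_color_class_nonempty[OF assms(2,3) _ that] assms(5) that
      unfolding color_class_def by blast
    then obtain p where p: "\<And>i. i \<in> {1..k} \<Longrightarrow> c (p i) = i"
      by metis
    define a :: "nat \<Rightarrow> nat \<Rightarrow> real"
      where "a i j = (if j = i then 1 else 0) - (if j = k then 1 else 0)" for i j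
    have "(\<Sum>j = 1..k. a i j) = 0" if "i \<in> {1..<k}" for i
      using that by (simp add: a_def sum_subtractf)
    then have "(\<lambda>i. \<chi> v. a i (c v)) ` {1..<k} \<subseteq>
        {x. normalized_laplacian adj *v x = (real k * \<alpha>) *s x}"
      using FAT_coloring_eigenvector[OF assms(2,3)] by auto
    \<comment> \<open>Since j < k, the representative \<open>p j\<close> lies outside the last
      class, where the subtracted indicator lives.\<close>
    moreover have "(\<chi> v. a i (c v)) $ p j = (if i = j then 1 else 0)"
      if "i \<in> {1..<k}" "j \<in> {1..<k}" for i j
      using that p by (simp add: a_def)
    ultimately have "card {1..<k} \<le> dim {x. normalized_laplacian adj *v x = (real k * \<alpha>) *s x}"
      by (rule card_le_dim_if_dual_coordinates)
    then show ?thesis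
      by (simp add: eigen_multiplicity_def)
  qed
  have "1 \<le> eigen_multiplicity (normalized_laplacian adj) (real k * \<alpha>)"
  proof (cases "k = 1")
    case True
    \<comment> \<open>Here the values sum to 1, not 0; the eigenvector condition holds through the
      factor \<alpha> = 0.\<close>
    have "normalized_laplacian adj *v (\<chi> v. 1) = (real k * \<alpha>) *s (\<chi> v. 1)"
      using FAT_coloring_eigenvector[OF assms(2,3), of "\<lambda>_. 1"] assms(4)[OF True] by simp
    moreover have "(\<chi> v. 1) \<noteq> (0 :: real ^ 'v)"
      by (simp add: vec_eq_iff)
    ultimately show ?thesis
      unfolding is_eigenvalue_iff_multiplicity[symmetric] is_eigenvalue_def by blast
  next
    case False
    with \<open>k \<ge> 1\<close> mult show ?thesis
      by linarith
  qed
  with mult show ?thesis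
    by (simp add: is_eigenvalue_iff_multiplicity)
qed

end
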